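(* Let $N\ge1$, $n\ge1$ be integers, $\mu,\lambda\in\{1,-1\}$, $s\in\{1,\dots,N\}$, $k\in\{0,\dots,N-1\}$, $p,q\in\{0,1\}$, and let $\mathscr{N}_{k,pq}^s$ be the $(2n+1)$-dimensional simple Yetter-Drinfeld module over the Suzuki algebra $A_{N\,2n+1}^{\mu\lambda}$ whose braiding $c$ is given in the context. Then the braided vector space $(\mathscr{N}_{k,pq}^s,c)$ is t-equivalent to a braided vector space associated to the dihedral rack $\mathbb{D}_{2n+1}$.
   Context: $\Bbbk$ is an algebraically closed field of characteristic $0$. The statement depends only on the braided vector space underlying $\mathscr{N}_{k,pq}^s$, which is as follows. It has basis $w_1,\dots,w_{2n+1}$. Let $\omega$ be a primitive $8N(2n+1)$-th root of unity and $B=\bar\mu^{1/2}\omega^{2k(2n+1)}$, where $\bar\mu\in\Bbbk^\times$ is the fixed nonzero scalar attached to $\mu$ and $\bar\mu^{1/2}$ a fixed square root of it. For nonnegative integers $\gamma$ define $$R^{\gamma}(w_\alpha\otimes w_\beta)=\begin{cases}w_{\beta+\gamma}\otimes w_{2n-\alpha+2}, & \beta+\gamma\le 2n+1,\\ (-1)^p\lambda B\,w_{2n+1}\otimes w_{2n-\alpha+2}, & \beta+\gamma=2n+2,\\ (-1)^p\lambda B^{2(\gamma+\beta)-4n-3}\,w_{4n+3-\gamma-\beta}\otimes w_{2n-\alpha+2}, & \beta+\gamma\ge 2n+3,\end{cases}$$ $$L^{\gamma}(w_\alpha\otimes w_\beta)=\begin{cases}B^{2\gamma}\,w_{\beta-\gamma}\otimes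 w_{2n-\alpha+2}, & \gamma<\beta,\\ (-1)^pB^{2\beta-1}\,w_{\gamma-\beta+1}\otimes w_{2n-\alpha+2}, & \beta\le\gamma\le\beta+2n.\end{cases}$$ The braiding $c(w_\alpha\otimes w_\beta)$, for $\alpha,\beta\in\{1,\dots,2n+1\}$, equals: - $(-1)^qB^{2(\alpha+s-1)}\,w_\beta\otimes w_{2n-\alpha+2}$ if $\alpha=n+1$; - $(-1)^qB^{2(2\alpha+s-n-2)}L^{2(n-\alpha+1)}(w_\alpha\otimes w_\beta)$ if $\alpha<n+1$ and $\alpha+\beta$ is even; - $(-1)^qB^{2(s+n)}L^{2(\alpha-1-n)}(w_\alpha\otimes w_\beta)$ if $\alpha>n+1$ and $\alpha+\beta$ is odd; - $(-1)^qB^{2(2\alpha+s-n-2)}R^{2(n-\alpha+1)}(w_\alpha\otimes w_\beta)$ if $\alpha<n+1$ and $\alpha+\beta$ is odd; - $(-1)^qB^{2(s+n)}R^{2(\alpha-1-n)}(w_\alpha\otimes w_\beta)$ if $\alpha>n+1$ and $\alpha+\beta$ is even. t-equivalence: braided vector spaces $(V,c)$ and $(W,\tilde c)$ are t-equivalent if there are linear isomorphisms $U^m:V^{\otimes m}\to W^{\otimes m}$ for all $m\ge2$ intertwining the corresponding representations of the braid group $\mathbb{B}_m$ (i.e. $U^mc_i=\tilde c_iU^m$ for $1\le i\le m-1$, where $c_i$ is $c$ acting on tensor factors $i,i+1$). The dihedral rack is $\mathbb{D}_m=(\mathbb{Z}_m,\rhd)$ with $i\rhd j=2i-j$. A braided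 vector space is associated to $\mathbb{D}_m$ if it has a basis $(u_i)_{i\in\mathbb{Z}_m}$ with $c(u_i\otimes u_j)=R_{i,j}\,u_{i\rhd j}\otimes u_i$, $R_{i,j}\in\Bbbk^\times$. *)

theory Defs
  imports "HOL-Library.Poly_Mapping" "HOL-Computational_Algebra.Polynomial"
begin

section \<open>Tensor powers of a vector space with basis\<close>

text \<open>
  A vector space \<open>V\<close> with basis \<open>(w\<^sub>a)\<close>, \<open>a \<in> I\<close>, is modelled together with its tensor powers
  inside the free vector space on words over \<open>I\<close>: the word \<open>[a\<^sub>1, \<dots>, a\<^sub>m]\<close> is the basis tensor
  \<open>w\<^sub>a\<^sub>1 \<otimes> \<dots> \<otimes> w\<^sub>a\<^sub>m\<close> of the \<open>m\<close>-th tensor power, and \<open>V\<close> itself is the first tensor power.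
\<close>

definition tscale :: "'k::field \<Rightarrow> ('w \<Rightarrow>\<^sub>0 'k) \<Rightarrow> ('w \<Rightarrow>\<^sub>0 'k)"  (infixr \<open>*\<^sub>t\<close> 75)
  where "a *\<^sub>t x = Poly_Mapping.map ((*) a) x"

lemma lookup_tscale [simp]: "Poly_Mapping.lookup (a *\<^sub>t x) w = a * Poly_Mapping.lookup x w"
  by (simp add: tscale_def map.rep_eq when_def)

global_interpretation tvs: vector_space "tscale :: 'k::field \<Rightarrow> ('w \<Rightarrow>\<^sub>0 'k) \<Rightarrow> ('w \<Rightarrow>\<^sub>0 'k)"
  defines tspan = tvs.span and tdependent = tvs.dependent
  by unfold_locales (auto intro!: poly_mapping_eqI simp: lookup_add algebra_simps)

definition bas :: "'i list \<Rightarrow> ('i list \<Rightarrow>\<^sub>0 'k::field)"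
  where "bas w = Poly_Mapping.single w 1"

definition tensor_power :: "'i set \<Rightarrow> nat \<Rightarrow> ('i list \<Rightarrow>\<^sub>0 'k::field) set"
  where "tensor_power I m = {x. \<forall>w \<in> Poly_Mapping.keys x. set w \<subseteq> I \<and> length w = m}"

text \<open>The linear map with prescribed values on basis words.\<close>

definition lin_ext :: "('v \<Rightarrow> ('w \<Rightarrow>\<^sub>0 'k)) \<Rightarrow> ('v \<Rightarrow>\<^sub>0 'k::field) \<Rightarrow> ('w \<Rightarrow>\<^sub>0 'k)"
  where "lin_ext f x = (\<Sum>w \<in> Poly_Mapping.keys x. Poly_Mapping.lookup x w *\<^sub>t f w)"

definition tensor :: "('i list \<Rightarrow>\<^sub>0 'k::field) \<Rightarrow> ('i list \<Rightarrow>\<^sub>0 'k) \<Rightarrow> ('i list \<Rightarrow>\<^sub>0 'k)"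
    (infixr \<open>\<otimes>\<^sub>t\<close> 70)
  where "x \<otimes>\<^sub>t y = lin_ext (\<lambda>u. lin_ext (\<lambda>v. bas (u @ v)) y) x"

definition linear_iso_on ::
    "('v \<Rightarrow>\<^sub>0 'k::field) set \<Rightarrow> ('w \<Rightarrow>\<^sub>0 'k) set \<Rightarrow> (('v \<Rightarrow>\<^sub>0 'k) \<Rightarrow> ('w \<Rightarrow>\<^sub>0 'k)) \<Rightarrow> bool"
  where "linear_iso_on S T f \<longleftrightarrow> bij_betw f S T \<and>
     (\<forall>x\<in>S. \<forall>y\<in>S. f (x + y) = f x + f y) \<and> (\<forall>a. \<forall>x\<in>S. f (a *\<^sub>t x) = a *\<^sub>t f x)"


section \<open>Braided vector spaces and t-equivalence\<close>

text \<open>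
  \<open>braid_act c i\<close> is \<open>id \<otimes> c \<otimes> id\<close> with \<open>c\<close> acting on the tensor factors \<open>i\<close> and \<open>i + 1\<close>,
  counted from 1; it is used on \<open>tensor_power I m\<close> for \<open>1 \<le> i < m\<close> only.
\<close>

definition braid_act ::
    "(('i list \<Rightarrow>\<^sub>0 'k) \<Rightarrow> ('i list \<Rightarrow>\<^sub>0 'k)) \<Rightarrow> nat \<Rightarrow> ('i list \<Rightarrow>\<^sub>0 'k::field) \<Rightarrow> ('i list \<Rightarrow>\<^sub>0 'k)"
  where "braid_act c i = lin_ext (\<lambda>w.
     bas (take (i - 1) w) \<otimes>\<^sub>t c (bas [w ! (i - 1), w ! i]) \<otimes>\<^sub>t bas (drop (i + 1) w))"

definition braided_vector_space ::
    "'i set \<Rightarrow> (('i list \<Rightarrow>\<^sub>0 'k) \<Rightarrow> ('i list \<Rightarrow>\<^sub>0 'k::field)) \<Rightarrow> bool"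
  where "braided_vector_space I c \<longleftrightarrow>
     linear_iso_on (tensor_power I 2) (tensor_power I 2) c \<and>
     (\<forall>x \<in> tensor_power I 3.
        braid_act c 1 (braid_act c 2 (braid_act c 1 x)) =
        braid_act c 2 (braid_act c 1 (braid_act c 2 x)))"

definition t_equivalent ::
    "'i set \<Rightarrow> (('i list \<Rightarrow>\<^sub>0 'k) \<Rightarrow> ('i list \<Rightarrow>\<^sub>0 'k)) \<Rightarrow>
     'j set \<Rightarrow> (('j list \<Rightarrow>\<^sub>0 'k) \<Rightarrow> ('j list \<Rightarrow>\<^sub>0 'k::field)) \<Rightarrow> bool"
  where "t_equivalent I c J c' \<longleftrightarrow>
     braided_vector_space I c \<and> braided_vector_space J c' \<and>
     (\<exists>U :: nat \<Rightarrow> ('i list \<Rightarrow>\<^sub>0 'k) \<Rightarrow> ('j list \<Rightarrow>\<^sub>0 'k).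
        \<forall>m\<ge>2. linear_iso_on (tensor_power I m) (tensor_power J m) (U m) \<and>
          (\<forall>i \<in> {1..m-1}. \<forall>x \<in> tensor_power I m.
             U m (braid_act c i x) = braid_act c' i (U m x)))"


section \<open>Dihedral racks\<close>

text \<open>The dihedral rack on \<open>\<int>/m\<int>\<close>, with residues represented by \<open>{0..<m}\<close>.\<close>

definition dihedral_op :: "nat \<Rightarrow> int \<Rightarrow> int \<Rightarrow> int"
  where "dihedral_op m i j = (2 * i - j) mod int m"

definition is_basis_family ::
    "'b set \<Rightarrow> ('b \<Rightarrow> ('w \<Rightarrow>\<^sub>0 'k::field)) \<Rightarrow> ('w \<Rightarrow>\<^sub>0 'k) set \<Rightarrow> bool"
  where "is_basis_family X u S \<longleftrightarrow> inj_on u X \<and> \<not> tdependent (u ` X) \<and> tspan (u ` X) = S"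

definition associated_to_dihedral_rack ::
    "nat \<Rightarrow> 'i set \<Rightarrow> (('i list \<Rightarrow>\<^sub>0 'k) \<Rightarrow> ('i list \<Rightarrow>\<^sub>0 'k::field)) \<Rightarrow> bool"
  where "associated_to_dihedral_rack m I c \<longleftrightarrow>
     braided_vector_space I c \<and>
     (\<exists>(u :: int \<Rightarrow> ('i list \<Rightarrow>\<^sub>0 'k)) (R :: int \<Rightarrow> int \<Rightarrow> 'k).
        is_basis_family {0..<int m} u (tensor_power I 1) \<and>
        (\<forall>i \<in> {0..<int m}. \<forall>j \<in> {0..<int m}.
           R i j \<noteq> 0 \<and> c (u i \<otimes>\<^sub>t u j) = R i j *\<^sub>t (u (dihedral_op m i j) \<otimes>\<^sub>t u i)))"


section \<open>The braiding of the simple Yetter-Drinfeld module\<close>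

definition primitive_root_of_unity :: "nat \<Rightarrow> 'k::field \<Rightarrow> bool"
  where "primitive_root_of_unity m z \<longleftrightarrow> m > 0 \<and> z ^ m = 1 \<and> (\<forall>j. 0 < j \<and> j < m \<longrightarrow> z ^ j \<noteq> 1)"

text \<open>
  Basis indices are integers in \<open>{1..2n+1}\<close>, so that subtraction in indices and exponents is
  the true one; exponents of \<open>B\<close> can be negative.  \<open>R_op \<dots> \<gamma> \<alpha> \<beta>\<close> and \<open>L_op \<dots> \<gamma> \<alpha> \<beta>\<close> are
  \<open>R\<^sup>\<gamma>(w\<^sub>\<alpha> \<otimes> w\<^sub>\<beta>)\<close> and \<open>L\<^sup>\<gamma>(w\<^sub>\<alpha> \<otimes> w\<^sub>\<beta>)\<close>; the upper index is part of the name, not an iteration.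
  The last branch of \<open>L_op\<close> is used for \<open>\<beta> \<le> \<gamma> \<le> \<beta> + 2n\<close> only, which always holds below.
\<close>

definition R_op :: "nat \<Rightarrow> nat \<Rightarrow> 'k::field \<Rightarrow> 'k \<Rightarrow> int \<Rightarrow> int \<Rightarrow> int \<Rightarrow> (int list \<Rightarrow>\<^sub>0 'k)"
  where "R_op n p lam B \<gamma> \<alpha> \<beta> =
    (if \<beta> + \<gamma> \<le> 2 * int n + 1 then
       bas [\<beta> + \<gamma>, 2 * int n - \<alpha> + 2]
     else if \<beta> + \<gamma> = 2 * int n + 2 then
       ((-1) ^ p * lam * B) *\<^sub>t bas [2 * int n + 1, 2 * int n - \<alpha> + 2]
     else
       ((-1) ^ p * lam * B powi (2 * (\<gamma> + \<beta>) - 4 * int n - 3)) *\<^sub>t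
         bas [4 * int n + 3 - \<gamma> - \<beta>, 2 * int n - \<alpha> + 2])"

definition L_op :: "nat \<Rightarrow> nat \<Rightarrow> 'k::field \<Rightarrow> int \<Rightarrow> int \<Rightarrow> int \<Rightarrow> (int list \<Rightarrow>\<^sub>0 'k)"
  where "L_op n p B \<gamma> \<alpha> \<beta> =
    (if \<gamma> < \<beta> then
       B powi (2 * \<gamma>) *\<^sub>t bas [\<beta> - \<gamma>, 2 * int n - \<alpha> + 2]
     else
       ((-1) ^ p * B powi (2 * \<beta> - 1)) *\<^sub>t bas [\<gamma> - \<beta> + 1, 2 * int n - \<alpha> + 2])"

definition suzuki_braiding_basis ::
    "nat \<Rightarrow> nat \<Rightarrow> nat \<Rightarrow> nat \<Rightarrow> 'k::field \<Rightarrow> 'k \<Rightarrow> int \<Rightarrow> int \<Rightarrow> (int list \<Rightarrow>\<^sub>0 'k)"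
  where "suzuki_braiding_basis n s p q lam B \<alpha> \<beta> =
    (if \<alpha> = int n + 1 then
       ((-1) ^ q * B powi (2 * (\<alpha> + int s - 1))) *\<^sub>t bas [\<beta>, 2 * int n - \<alpha> + 2]
     else if \<alpha> < int n + 1 \<and> even (\<alpha> + \<beta>) then
       ((-1) ^ q * B powi (2 * (2 * \<alpha> + int s - int n - 2))) *\<^sub>t
         L_op n p B (2 * (int n - \<alpha> + 1)) \<alpha> \<beta>
     else if \<alpha> > int n + 1 \<and> odd (\<alpha> + \<beta>) then
       ((-1) ^ q * B powi (2 * (int s + int n))) *\<^sub>t
         L_op n p B (2 * (\<alpha> - 1 - int n)) \<alpha> \<beta>
     else if \<alpha> < int n + 1 \<and> odd (\<alpha> + \<beta>) then
       ((-1) ^ q * B powi (2 * (2 * \<alpha> + int s - int n - 2))) *\<^sub>t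
         R_op n p lam B (2 * (int n - \<alpha> + 1)) \<alpha> \<beta>
     else
       ((-1) ^ q * B powi (2 * (int s + int n))) *\<^sub>t
         R_op n p lam B (2 * (\<alpha> - 1 - int n)) \<alpha> \<beta>)"

text \<open>Only the values on words of length 2 matter for the braiding.\<close>

definition suzuki_braiding ::
    "nat \<Rightarrow> nat \<Rightarrow> nat \<Rightarrow> nat \<Rightarrow> 'k::field \<Rightarrow> 'k \<Rightarrow> (int list \<Rightarrow>\<^sub>0 'k) \<Rightarrow> (int list \<Rightarrow>\<^sub>0 'k)"
  where "suzuki_braiding n s p q lam B =
    lin_ext (\<lambda>w. suzuki_braiding_basis n s p q lam B (w ! 0) (w ! 1))"

end

theory Submission
  imports Defs
begin

text \<open>
  Rescale the basis to \<open>u\<^sub>x = B\<^sup>-\<^sup>x w\<^sub>x\<close> and extend \<open>u\<close> to all integers by reflection at the two ends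
  of \<open>{1..2n+1}\<close>, namely \<open>u\<^sub>x = (-1)\<^sup>p u\<^sub>1\<^sub>-\<^sub>x\<close> and \<open>u\<^sub>x = (-1)\<^sup>p lam u\<^sub>4\<^sub>n\<^sub>+\<^sub>3\<^sub>-\<^sub>x\<close>.  The boundary cases of
  \<open>R\<^sup>\<gamma>\<close> and \<open>L\<^sup>\<gamma>\<close> are exactly these reflections.  They give \<open>u\<^sub>x\<^sub>+\<^sub>4\<^sub>n\<^sub>+\<^sub>2 = lam u\<^sub>x\<close> and allow every
  even index to be replaced by an odd one.  In the odd indices all cases of the braiding become the
  single formula
  \<open>c (u\<^sub>a \<otimes> u\<^sub>b) = C u\<^sub>2\<^sub>a\<^sub>+\<^sub>b\<^sub>-\<^sub>2\<^sub>n\<^sub>-\<^sub>2 \<otimes> u\<^sub>2\<^sub>n\<^sub>+\<^sub>2\<^sub>-\<^sub>a\<close>  with  \<open>C = (-1)\<^sup>q B\<^sup>2\<^sup>(\<^sup>s\<^sup>+\<^sup>n\<^sup>)\<close>.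

  The involution \<open>\<phi> u\<^sub>a = u\<^sub>2\<^sub>n\<^sub>+\<^sub>2\<^sub>-\<^sub>a\<close> is well defined on odd indices because \<open>lam\<^sup>2 = 1\<close>, and \<open>\<phi> \<otimes> \<phi>\<close>
  commutes with \<open>c\<close>.  Hence \<open>U\<^sup>m = 1 \<otimes> \<phi> \<otimes> \<phi>\<^sup>2 \<otimes> \<dots>\<close> conjugates \<open>c\<^sub>i\<close> into \<open>c'\<^sub>i\<close>, where
  \<open>c' = (1 \<otimes> \<phi>) c (1 \<otimes> \<phi>)\<close> satisfies \<open>c' (u\<^sub>a \<otimes> u\<^sub>b) = C u\<^sub>2\<^sub>a\<^sub>-\<^sub>b \<otimes> u\<^sub>a\<close>.  With \<open>a = 2i+1\<close> this is the
  dihedral rack on \<open>i\<close> modulo \<open>2n+1\<close>, with a cocycle \<open>C\<close> or \<open>C lam\<close> that records how often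
  \<open>2i-j\<close> wraps around.

  Every map involved sends basis words to multiples of basis words, so the argument is one
  about words and scalars: \<open>t_equivalent_subst\<close> reduces a t-equivalence of this kind to identities on
  pairs of adjacent letters, \<open>braided_dihedral\<close> treats \<open>c'\<close>, and \<open>suzuki_braiding_basis_eq\<close> together
  with \<open>reflect_rack_index\<close> and \<open>rack_index_target\<close> gives the uniform formula for \<open>c\<close>.
\<close>

section \<open>Linear extensions of maps on words\<close>

lemma lin_ext_superset:
  assumes "finite S" "Poly_Mapping.keys x \<subseteq> S"
  shows "lin_ext f x = (\<Sum>w\<in>S. Poly_Mapping.lookup x w *\<^sub>t f w)"
  unfolding lin_ext_def
  by (rule sum.mono_neutral_left) (use assms in \<open>auto simp: in_keys_iff\<close>)

lemma lin_ext_add: "lin_ext f (x + y) = lin_ext f x + lin_ext f y"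
proof -
  let ?S = "Poly_Mapping.keys x \<union> Poly_Mapping.keys y"
  have "Poly_Mapping.keys (x + y) \<subseteq> ?S"
    by (rule Poly_Mapping.keys_add)
  then show ?thesis
    by (simp add: lin_ext_superset[of ?S] lookup_add tvs.scale_left_distrib sum.distrib)
qed

lemma keys_tscale: "Poly_Mapping.keys (a *\<^sub>t x) \<subseteq> Poly_Mapping.keys x"
  by (auto simp: in_keys_iff)

lemma lin_ext_tscale: "lin_ext f (a *\<^sub>t x) = a *\<^sub>t lin_ext f x"
  by (simp add: lin_ext_superset[of "Poly_Mapping.keys x"] keys_tscale tvs.scale_sum_right)

lemma lin_ext_sum: "lin_ext f (\<Sum>a\<in>A. h a) = (\<Sum>a\<in>A. lin_ext f (h a))"
proof (induction A rule: infinite_finite_induct)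
  case (insert a A)
  then show ?case by (simp add: lin_ext_add)
qed (simp_all add: lin_ext_def)

lemma keys_bas [simp]: "Poly_Mapping.keys (bas w) = {w}"
  by (simp add: bas_def)

lemma lin_ext_bas [simp]: "lin_ext f (bas w) = f w"
  by (simp add: lin_ext_def) (simp add: bas_def)

lemma lin_ext_comp: "lin_ext f (lin_ext g x) = lin_ext (\<lambda>w. lin_ext f (g w)) x"
  by (simp add: lin_ext_def[of g] lin_ext_def[of "\<lambda>w. lin_ext f (g w)"] lin_ext_sum lin_ext_tscale)

lemma lin_ext_cong:
  assumes "\<And>w. w \<in> Poly_Mapping.keys x \<Longrightarrow> f w = g w"
  shows "lin_ext f x = lin_ext g x"
  using assms by (simp add: lin_ext_def)

lemma lin_ext_bas_id: "lin_ext bas x = x"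
proof (rule poly_mapping_eqI)
  fix v
  have "Poly_Mapping.lookup (lin_ext bas x) v
      = (\<Sum>w\<in>Poly_Mapping.keys x. Poly_Mapping.lookup x w * (if w = v then 1 else 0))"
    by (simp add: lin_ext_def lookup_sum bas_def lookup_single when_def)
  also have "\<dots> = Poly_Mapping.lookup x v"
    by (simp add: in_keys_iff if_distrib sum.delta cong: if_cong)
  finally show "Poly_Mapping.lookup (lin_ext bas x) v = Poly_Mapping.lookup x v" .
qed

lemma tensor_bas [simp]: "bas u \<otimes>\<^sub>t bas v = bas (u @ v)"
  by (simp add: tensor_def)

lemma tensor_tscale_left: "(a *\<^sub>t x) \<otimes>\<^sub>t y = a *\<^sub>t (x \<otimes>\<^sub>t y)"
  by (simp add: tensor_def lin_ext_tscale)

lemma tensor_bas_tscale: "bas u \<otimes>\<^sub>t (a *\<^sub>t bas v) = a *\<^sub>t bas (u @ v)"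
  by (simp add: tensor_def lin_ext_tscale)

text \<open>The words that form a basis of a tensor power.\<close>

definition words :: "'i set \<Rightarrow> nat \<Rightarrow> 'i list set"
  where "words I m = {w. set w \<subseteq> I \<and> length w = m}"

lemma tensor_power_iff: "x \<in> tensor_power I m \<longleftrightarrow> Poly_Mapping.keys x \<subseteq> words I m"
  by (auto simp: tensor_power_def words_def)

lemma words_2E:
  assumes "w \<in> words I 2"
  obtains a b where "w = [a, b]" "a \<in> I" "b \<in> I"
  using assms by (auto simp: words_def numeral_2_eq_2 length_Suc_conv)

lemma words_3E:
  assumes "w \<in> words I 3"
  obtains a b c where "w = [a, b, c]" "a \<in> I" "b \<in> I" "c \<in> I"
  using assms by (auto simp: words_def numeral_3_eq_3 length_Suc_conv)

lemma words_splitE: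
  assumes "w \<in> words I m" "1 \<le> i" "i \<le> m - 1"
  obtains u a b v where "w = u @ [a, b] @ v" "length u = i - 1" "a \<in> I" "b \<in> I"
    "set u \<subseteq> I" "set v \<subseteq> I" "length u + length v + 2 = m"
proof -
  have len: "length w = m" "set w \<subseteq> I"
    using assms by (auto simp: words_def)
  have lt: "i - 1 < length w" "i < length w"
    using len assms by auto
  have "w = take (i - 1) w @ [w ! (i - 1), w ! i] @ drop (i + 1) w"
    using lt assms(2) id_take_nth_drop[OF lt(1)] Cons_nth_drop_Suc[OF lt(2)] by simp
  then show thesis
    by (rule that) (use len lt assms in \<open>auto simp: min_def dest: in_set_takeD in_set_dropD\<close>)
qed

lemma lin_ext_in_tensor_power:
  assumes "x \<in> tensor_power I m"
    and "\<And>w. w \<in> words I m \<Longrightarrow> f w \<in> tensor_power J l"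
  shows "lin_ext f x \<in> tensor_power J l"
proof -
  have "Poly_Mapping.keys (lin_ext f x)
      \<subseteq> (\<Union>w\<in>Poly_Mapping.keys x. Poly_Mapping.keys (Poly_Mapping.lookup x w *\<^sub>t f w))"
    unfolding lin_ext_def by (rule Poly_Mapping.keys_sum)
  also have "\<dots> \<subseteq> words J l"
  proof (rule UN_least)
    fix w assume "w \<in> Poly_Mapping.keys x"
    then have "Poly_Mapping.keys (f w) \<subseteq> words J l"
      using assms by (auto simp: tensor_power_iff)
    then show "Poly_Mapping.keys (Poly_Mapping.lookup x w *\<^sub>t f w) \<subseteq> words J l"
      by (rule order_trans[OF keys_tscale])
  qed
  finally show ?thesis by (simp add: tensor_power_iff)
qed

lemma monomial_in_tensor_power:
  "w \<in> words J l \<Longrightarrow> a *\<^sub>t bas w \<in> tensor_power J l"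
  using keys_tscale[of a "bas w"] by (auto simp: tensor_power_iff)

text \<open>A linear map that sends basis words to nonzero multiples of basis words, bijectively
  between two sets of words, is an isomorphism of the spaces they span.\<close>

lemma linear_iso_on_monomial:
  assumes f: "\<And>w. w \<in> words I m \<Longrightarrow> f w = \<kappa> w *\<^sub>t bas (\<sigma> w)"
    and \<kappa>: "\<And>w. w \<in> words I m \<Longrightarrow> \<kappa> w \<noteq> 0"
    and \<sigma>: "bij_betw \<sigma> (words I m) (words J l)"
  shows "linear_iso_on (tensor_power I m) (tensor_power J l) (lin_ext f)"
proof -
  define \<rho> where "\<rho> = the_inv_into (words I m) \<sigma>"
  define g where "g = (\<lambda>v. inverse (\<kappa> (\<rho> v)) *\<^sub>t bas (\<rho> v))"
  have \<rho>: "bij_betw \<rho> (words J l) (words I m)"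
    unfolding \<rho>_def by (rule bij_betw_the_inv_into[OF \<sigma>])
  have \<rho>\<sigma>: "\<rho> (\<sigma> w) = w" if "w \<in> words I m" for w
    using \<sigma> that by (simp add: \<rho>_def bij_betw_def the_inv_into_f_f)
  have \<sigma>\<rho>: "\<sigma> (\<rho> v) = v" if "v \<in> words J l" for v
    using \<sigma> that by (simp add: \<rho>_def f_the_inv_into_f_bij_betw)
  have \<sigma>in: "\<sigma> w \<in> words J l" if "w \<in> words I m" for w
    using \<sigma> that by (rule bij_betwE[rule_format])
  have \<rho>in: "\<rho> v \<in> words I m" if "v \<in> words J l" for v
    using \<rho> that by (rule bij_betwE[rule_format])
  have gf: "lin_ext g (lin_ext f x) = x" if "x \<in> tensor_power I m" for x
  proof -
    have "lin_ext g (lin_ext f x) = lin_ext bas x"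
      unfolding lin_ext_comp
    proof (rule lin_ext_cong)
      fix w assume "w \<in> Poly_Mapping.keys x"
      then have "w \<in> words I m" using that by (auto simp: tensor_power_iff)
      then show "lin_ext g (f w) = bas w"
        using \<kappa> by (simp add: f lin_ext_tscale g_def \<rho>\<sigma>)
    qed
    then show ?thesis by (simp add: lin_ext_bas_id)
  qed
  have fg: "lin_ext f (lin_ext g x) = x" if "x \<in> tensor_power J l" for x
  proof -
    have "lin_ext f (lin_ext g x) = lin_ext bas x"
      unfolding lin_ext_comp
    proof (rule lin_ext_cong)
      fix v assume "v \<in> Poly_Mapping.keys x"
      then have "v \<in> words J l" using that by (auto simp: tensor_power_iff)
      then show "lin_ext f (g v) = bas v"
        using \<kappa> by (simp add: f lin_ext_tscale g_def \<sigma>\<rho> \<rho>in)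
    qed
    then show ?thesis by (simp add: lin_ext_bas_id)
  qed
  have "bij_betw (lin_ext f) (tensor_power I m) (tensor_power J l)"
  proof (rule bij_betw_byWitness[where f' = "lin_ext g"])
    show "lin_ext f ` tensor_power I m \<subseteq> tensor_power J l"
    proof (rule image_subsetI, erule lin_ext_in_tensor_power)
      show "f w \<in> tensor_power J l" if "w \<in> words I m" for w
        using that by (simp add: f \<sigma>in monomial_in_tensor_power)
    qed
    show "lin_ext g ` tensor_power J l \<subseteq> tensor_power I m"
    proof (rule image_subsetI, erule lin_ext_in_tensor_power)
      show "g w \<in> tensor_power I m" if "w \<in> words J l" for w
        using that by (simp add: g_def \<rho>in monomial_in_tensor_power)
    qed
  qed (use gf fg in auto)
  then show ?thesis
    by (simp add: linear_iso_on_def lin_ext_add lin_ext_tscale)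
qed

lemma is_basis_family_letters:
  assumes "inj_on u X"
  shows "is_basis_family X (\<lambda>i. bas [u i]) (tensor_power (u ` X) 1 :: ('i list \<Rightarrow>\<^sub>0 'k::field) set)"
proof -
  have keys: "Poly_Mapping.keys x \<subseteq> S" if "x \<in> tspan (bas ` S)"
    for x :: "'i list \<Rightarrow>\<^sub>0 'k" and S
  proof -
    have "tspan (bas ` S) \<subseteq> {x :: 'i list \<Rightarrow>\<^sub>0 'k. Poly_Mapping.keys x \<subseteq> S}"
    proof (rule tvs.span_minimal)
      show "tvs.subspace {x :: 'i list \<Rightarrow>\<^sub>0 'k. Poly_Mapping.keys x \<subseteq> S}"
        by (rule tvs.subspaceI)
          (auto dest: subsetD[OF Poly_Mapping.keys_add] subsetD[OF keys_tscale])
    qed auto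
    then show ?thesis using that by blast
  qed
  let ?W = "(\<lambda>i. [u i]) ` X"
  have inj_bas: "inj (bas :: 'i list \<Rightarrow> ('i list \<Rightarrow>\<^sub>0 'k))"
    by (rule injI) (metis keys_bas singleton_inject)
  have img: "(\<lambda>i. bas [u i]) ` X = bas ` ?W" by (simp add: image_image)
  have W: "words (u ` X) 1 = ?W"
    by (auto simp: words_def length_Suc_conv)
  have "\<not> tdependent (bas ` ?W :: ('i list \<Rightarrow>\<^sub>0 'k) set)"
  proof
    assume "tdependent (bas ` ?W :: ('i list \<Rightarrow>\<^sub>0 'k) set)"
    then obtain w where w: "w \<in> ?W" "bas w \<in> tspan (bas ` ?W - {bas w} :: ('i list \<Rightarrow>\<^sub>0 'k) set)"
      unfolding tvs.dependent_def by blast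
    have "bas ` ?W - {bas w} = (bas ` (?W - {w}) :: ('i list \<Rightarrow>\<^sub>0 'k) set)"
      using inj_bas by (auto simp: inj_eq)
    then show False using keys[of "bas w" "?W - {w}"] w by auto
  qed
  moreover have "tspan (bas ` ?W) = (tensor_power (u ` X) 1 :: ('i list \<Rightarrow>\<^sub>0 'k) set)"
  proof
    show "tspan (bas ` ?W) \<subseteq> (tensor_power (u ` X) 1 :: ('i list \<Rightarrow>\<^sub>0 'k) set)"
    proof
      fix x :: "'i list \<Rightarrow>\<^sub>0 'k" assume "x \<in> tspan (bas ` ?W)"
      then show "x \<in> tensor_power (u ` X) 1" unfolding tensor_power_iff W by (rule keys)
    qed
    show "tensor_power (u ` X) 1 \<subseteq> (tspan (bas ` ?W) :: ('i list \<Rightarrow>\<^sub>0 'k) set)"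
    proof
      fix x :: "'i list \<Rightarrow>\<^sub>0 'k" assume "x \<in> tensor_power (u ` X) 1"
      then have "lin_ext bas x \<in> tspan (bas ` ?W)"
        unfolding lin_ext_def tensor_power_iff W
        by (intro tvs.span_sum tvs.span_scale tvs.span_base) auto
      then show "x \<in> tspan (bas ` ?W)" by (simp add: lin_ext_bas_id)
    qed
  qed
  moreover have "inj_on (\<lambda>i. bas [u i] :: 'i list \<Rightarrow>\<^sub>0 'k) X"
    by (rule inj_onI) (use assms inj_bas in \<open>simp add: inj_eq inj_on_eq_iff\<close>)
  ultimately show ?thesis
    unfolding is_basis_family_def img by blast
qed


section \<open>Braidings that are monomial in the basis of words\<close>

lemma braid_act_bas:
  assumes "c (bas [a, b]) = q *\<^sub>t bas [a', b']" "i = Suc (length u)"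
  shows "braid_act c i (bas (u @ [a, b] @ v)) = q *\<^sub>t bas (u @ [a', b'] @ v)"
  using assms by (simp add: braid_act_def tensor_tscale_left tensor_bas_tscale nth_append)

lemma braid_act_degree_2:
  assumes "x \<in> tensor_power I 2" "c = lin_ext f"
    and "\<And>w. w \<in> words I 2 \<Longrightarrow> \<exists>r a b. f w = r *\<^sub>t bas [a, b]"
  shows "braid_act c 1 x = c x"
  unfolding assms(2) braid_act_def
proof (rule lin_ext_cong)
  fix w assume "w \<in> Poly_Mapping.keys x"
  then have "w \<in> words I 2" using assms(1) by (auto simp: tensor_power_iff)
  then obtain a b r a' b' where "w = [a, b]" "f [a, b] = r *\<^sub>t bas [a', b']"
    using assms(3) by (metis words_2E)
  then show "bas (take (1 - 1) w) \<otimes>\<^sub>t lin_ext f (bas [w ! (1 - 1), w ! 1])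
      \<otimes>\<^sub>t bas (drop (1 + 1) w) = f w"
    by (simp add: tensor_tscale_left tensor_bas_tscale)
qed

lemma braid_act_lin_ext: "braid_act c i (lin_ext f x) = lin_ext (\<lambda>w. braid_act c i (f w)) x"
  by (simp add: braid_act_def lin_ext_comp)

lemma braid_act_tscale: "braid_act c i (a *\<^sub>t x) = a *\<^sub>t braid_act c i x"
  by (simp add: braid_act_def lin_ext_tscale)

text \<open>A letterwise substitution that may depend on the position: the letter \<open>a\<close> in position
  \<open>k\<close> becomes \<open>lt k a\<close>, with coefficient \<open>cf k a\<close>.\<close>

fun subst_word :: "(nat \<Rightarrow> 'i \<Rightarrow> 'j) \<Rightarrow> nat \<Rightarrow> 'i list \<Rightarrow> 'j list" where
  "subst_word lt k [] = []"
| "subst_word lt k (a # w) = lt k a # subst_word lt (Suc k) w"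

fun subst_coeff :: "(nat \<Rightarrow> 'i \<Rightarrow> 'k::field) \<Rightarrow> nat \<Rightarrow> 'i list \<Rightarrow> 'k" where
  "subst_coeff cf k [] = 1"
| "subst_coeff cf k (a # w) = cf k a * subst_coeff cf (Suc k) w"

lemma length_subst_word [simp]: "length (subst_word lt k w) = length w"
  by (induction w arbitrary: k) auto

lemma subst_word_append:
  "subst_word lt k (u @ v) = subst_word lt k u @ subst_word lt (k + length u) v"
  by (induction u arbitrary: k) auto

lemma subst_coeff_append:
  "subst_coeff cf k (u @ v) = subst_coeff cf k u * subst_coeff cf (k + length u) v"
  by (induction u arbitrary: k) (auto simp: mult.assoc)

lemma subst_coeff_nonzero:
  "(\<And>k a. a \<in> I \<Longrightarrow> cf k a \<noteq> 0) \<Longrightarrow> set w \<subseteq> I \<Longrightarrow> subst_coeff cf k w \<noteq> 0"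
  by (induction w arbitrary: k) auto

lemma bij_betw_subst_word:
  assumes lt: "\<And>k. bij_betw (lt k) I J"
  shows "bij_betw (subst_word lt k) (words I m) (words J m)"
proof (rule bij_betw_imageI)
  have inj: "v = w" if "set v \<subseteq> I" "set w \<subseteq> I" "length v = length w"
    "subst_word lt k v = subst_word lt k w" for v w k
    using that(3,1,2,4)
  proof (induction v w arbitrary: k rule: list_induct2)
    case (Cons a v b w)
    then show ?case using lt[of k] by (auto simp: bij_betw_def inj_on_def)
  qed auto
  show "inj_on (subst_word lt k) (words I m)"
    using inj by (fastforce intro!: inj_onI simp: words_def)
  have into: "set (subst_word lt k w) \<subseteq> J" if "set w \<subseteq> I" for w k
    using that
  proof (induction w arbitrary: k)
    case (Cons a w)
    then show ?case using bij_betwE[OF lt[of k]] by auto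
  qed auto
  have onto: "\<exists>w. set w \<subseteq> I \<and> length w = length v \<and> subst_word lt k w = v"
    if "set v \<subseteq> J" for v k
    using that
  proof (induction v arbitrary: k)
    case (Cons b v)
    then obtain w where "set w \<subseteq> I" "length w = length v" "subst_word lt (Suc k) w = v"
      by fastforce
    moreover obtain a where "a \<in> I" "lt k a = b"
      using Cons.prems lt[of k] by (auto simp: bij_betw_def)
    ultimately show ?case by (intro exI[of _ "a # w"]) auto
  qed auto
  show "subst_word lt k ` words I m = words J m"
  proof
    show "subst_word lt k ` words I m \<subseteq> words J m"
      using into by (auto simp: words_def)
    show "words J m \<subseteq> subst_word lt k ` words I m"
    proof
      fix v assume "v \<in> words J m"
      then obtain w where "w \<in> words I m" "subst_word lt k w = v"
        using onto[of v k] by (auto simp: words_def)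
      then show "v \<in> subst_word lt k ` words I m" by blast
    qed
  qed
qed

text \<open>The transfer principle.  If the substitution intertwines the two monomial braidings on
  every pair of adjacent positions, then it is a t-equivalence; that \<open>c\<close> is invertible and
  satisfies the braid equation is then inherited from \<open>c'\<close>.\<close>

lemma t_equivalent_subst:
  fixes q :: "'i \<Rightarrow> 'i \<Rightarrow> 'k::field" and q' :: "'j \<Rightarrow> 'j \<Rightarrow> 'k"
  assumes c_def: "c = lin_ext f"
    and f: "\<And>a b. a \<in> I \<Longrightarrow> b \<in> I \<Longrightarrow> f [a, b] = q a b *\<^sub>t bas [g a b, h a b]"
    and gh: "\<And>a b. a \<in> I \<Longrightarrow> b \<in> I \<Longrightarrow> g a b \<in> I \<and> h a b \<in> I"
    and c'_def: "c' = lin_ext f'"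
    and f': "\<And>a b. a \<in> J \<Longrightarrow> b \<in> J \<Longrightarrow> f' [a, b] = q' a b *\<^sub>t bas [g' a b, h' a b]"
    and bvs': "braided_vector_space J c'"
    and lt: "\<And>k. bij_betw (lt k) I J"
    and cf: "\<And>k a. a \<in> I \<Longrightarrow> cf k a \<noteq> 0"
    and g': "\<And>k a b. a \<in> I \<Longrightarrow> b \<in> I \<Longrightarrow> g' (lt k a) (lt (Suc k) b) = lt k (g a b)"
    and h': "\<And>k a b. a \<in> I \<Longrightarrow> b \<in> I \<Longrightarrow> h' (lt k a) (lt (Suc k) b) = lt (Suc k) (h a b)"
    and q': "\<And>k a b. a \<in> I \<Longrightarrow> b \<in> I \<Longrightarrow>
       cf k a * cf (Suc k) b * q' (lt k a) (lt (Suc k) b)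
         = q a b * (cf k (g a b) * cf (Suc k) (h a b))"
  shows "t_equivalent I c J c'"
proof -
  define U where "U = lin_ext (\<lambda>w. subst_coeff cf 0 w *\<^sub>t bas (subst_word lt 0 w))"
  have U_bas: "U (bas w) = subst_coeff cf 0 w *\<^sub>t bas (subst_word lt 0 w)" for w
    by (simp add: U_def)
  have U_iso: "linear_iso_on (tensor_power I m) (tensor_power J m) U" for m
    unfolding U_def
  proof (rule linear_iso_on_monomial[OF refl])
    show "subst_coeff cf 0 w \<noteq> 0" if "w \<in> words I m" for w
      by (rule subst_coeff_nonzero[where I = I]) (use that cf in \<open>auto simp: words_def\<close>)
  qed (rule bij_betw_subst_word[OF lt])
  have c_bas: "c (bas [a, b]) = q a b *\<^sub>t bas [g a b, h a b]" if "a \<in> I" "b \<in> I" for a b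
    using that by (simp add: c_def f)
  have c'_bas: "c' (bas [a, b]) = q' a b *\<^sub>t bas [g' a b, h' a b]" if "a \<in> J" "b \<in> J" for a b
    using that by (simp add: c'_def f')
  have ltJ: "lt k a \<in> J" if "a \<in> I" for k a
    using bij_betwE[OF lt] that by blast
  have inter: "U (braid_act c i x) = braid_act c' i (U x)"
    if i: "1 \<le> i" "i \<le> m - 1" and x: "x \<in> tensor_power I m" for m i x
  proof -
    have word: "U (braid_act c i (bas w)) = braid_act c' i (U (bas w))" if wI: "w \<in> words I m" for w
    proof -
      obtain u a b v where w: "w = u @ [a, b] @ v" "length u = i - 1" and ab: "a \<in> I" "b \<in> I"
        using words_splitE[OF wI i] by metis
      define k where "k = length u"
      have i_eq: "i = Suc (length u)" using w i by simp
      have "U (braid_act c i (bas w)) = q a b *\<^sub>t U (bas (u @ [g a b, h a b] @ v))"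
        unfolding w(1) braid_act_bas[where c = c, OF c_bas[OF ab] i_eq] by (simp add: U_def lin_ext_tscale)
      also have "\<dots> = (subst_coeff cf 0 u * (q a b * (cf k (g a b) * cf (Suc k) (h a b)))
            * subst_coeff cf (Suc (Suc k)) v) *\<^sub>t
          bas (subst_word lt 0 u @ [lt k (g a b), lt (Suc k) (h a b)] @ subst_word lt (Suc (Suc k)) v)"
        by (simp add: U_bas subst_word_append subst_coeff_append k_def mult_ac)
      also have "\<dots> = subst_coeff cf 0 w *\<^sub>t q' (lt k a) (lt (Suc k) b) *\<^sub>t
          bas (subst_word lt 0 u @ [g' (lt k a) (lt (Suc k) b), h' (lt k a) (lt (Suc k) b)]
            @ subst_word lt (Suc (Suc k)) v)"
        unfolding q'[OF ab, symmetric]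
        by (simp add: g' h' ab w(1) subst_coeff_append k_def mult_ac)
      also have "\<dots> = subst_coeff cf 0 w *\<^sub>t braid_act c' i (bas (subst_word lt 0 w))"
        using braid_act_bas[where c = c' and u = "subst_word lt 0 u" and i = i
            and v = "subst_word lt (Suc (Suc k)) v", OF c'_bas[OF ltJ[OF ab(1)] ltJ[OF ab(2)]]]
        by (simp add: w(1) i_eq subst_word_append k_def)
      also have "\<dots> = braid_act c' i (U (bas w))"
        by (simp add: U_bas braid_act_def lin_ext_tscale)
      finally show ?thesis .
    qed
    show ?thesis
      unfolding braid_act_def U_def lin_ext_comp
    proof (rule lin_ext_cong)
      fix w assume "w \<in> Poly_Mapping.keys x"
      then have "w \<in> words I m" using x by (auto simp: tensor_power_iff)
      from word[OF this] show "lin_ext (\<lambda>w. subst_coeff cf 0 w *\<^sub>t bas (subst_word lt 0 w))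
          (bas (take (i - 1) w) \<otimes>\<^sub>t c (bas [w ! (i - 1), w ! i]) \<otimes>\<^sub>t bas (drop (i + 1) w))
        = lin_ext (\<lambda>w. bas (take (i - 1) w) \<otimes>\<^sub>t c' (bas [w ! (i - 1), w ! i])
              \<otimes>\<^sub>t bas (drop (i + 1) w)) (subst_coeff cf 0 w *\<^sub>t bas (subst_word lt 0 w))"
        by (simp add: braid_act_def U_def)
    qed
  qed
  have act_in: "braid_act c i x \<in> tensor_power I m"
    if i: "1 \<le> i" "i \<le> m - 1" and x: "x \<in> tensor_power I m" for m i x
  proof -
    have "bas (take (i - 1) w) \<otimes>\<^sub>t c (bas [w ! (i - 1), w ! i]) \<otimes>\<^sub>t bas (drop (i + 1) w)
        \<in> tensor_power I m" if wI: "w \<in> words I m" for w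
    proof -
      obtain u a b v where w: "w = u @ [a, b] @ v" "length u = i - 1" and ab: "a \<in> I" "b \<in> I"
        and uv: "set u \<subseteq> I" "set v \<subseteq> I" "length u + length v + 2 = m"
        using words_splitE[OF wI i] by metis
      have "i = Suc (length u)" using w i by simp
      from braid_act_bas[where c = c, OF c_bas[OF ab] this]
      have "braid_act c i (bas w) = q a b *\<^sub>t bas (u @ [g a b, h a b] @ v)"
        by (simp add: w)
      also have "\<dots> \<in> tensor_power I m"
        using uv gh[OF ab] by (intro monomial_in_tensor_power) (auto simp: words_def)
      finally show ?thesis by (simp add: braid_act_def)
    qed
    then show ?thesis
      unfolding braid_act_def by (intro lin_ext_in_tensor_power[OF x])
  qed
  show ?thesis
    unfolding t_equivalent_def
  proof (intro conjI exI[of _ "\<lambda>_. U"])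
    show "braided_vector_space I c"
      unfolding braided_vector_space_def
    proof
      have c1: "braid_act c 1 x = c x" if "x \<in> tensor_power I 2" for x
        using that c_def by (rule braid_act_degree_2) (metis f words_2E)
      have c'1: "braid_act c' 1 x = c' x" if "x \<in> tensor_power J 2" for x
        using that c'_def by (rule braid_act_degree_2) (metis f' words_2E)
      have comm: "U (c x) = c' (U x)" if "x \<in> tensor_power I 2" for x
      proof -
        have "U x \<in> tensor_power J 2"
          using U_iso[of 2] that by (auto simp: linear_iso_on_def bij_betw_def)
        then show ?thesis
          using inter[of 1 2 x] that c1[OF that] c'1 by simp
      qed
      have "bij_betw (c' \<circ> U) (tensor_power I 2) (tensor_power J 2)"
        using U_iso[of 2] bvs' unfolding linear_iso_on_def braided_vector_space_def
        by (blast intro: bij_betw_trans)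
      then have "bij_betw (U \<circ> c) (tensor_power I 2) (tensor_power J 2)"
        by (rule bij_betw_cong[THEN iffD1, rotated]) (simp add: comm)
      moreover have "c ` tensor_power I 2 \<subseteq> tensor_power I 2"
        using act_in[of 1 2] c1 by fastforce
      ultimately have "bij_betw c (tensor_power I 2) (tensor_power I 2)"
        using U_iso[of 2] by (subst bij_betw_comp_iff2[of U]) (auto simp: linear_iso_on_def)
      then show "linear_iso_on (tensor_power I 2) (tensor_power I 2) c"
        by (simp add: linear_iso_on_def c_def lin_ext_add lin_ext_tscale)
    next
      show "\<forall>x\<in>tensor_power I 3. braid_act c 1 (braid_act c 2 (braid_act c 1 x)) =
          braid_act c 2 (braid_act c 1 (braid_act c 2 x))"
      proof
        fix x :: "'i list \<Rightarrow>\<^sub>0 'k" assume x: "x \<in> tensor_power I 3"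
        have in1: "braid_act c 1 y \<in> tensor_power I 3" "braid_act c 2 y \<in> tensor_power I 3"
          and U1: "U (braid_act c 1 y) = braid_act c' 1 (U y)"
            "U (braid_act c 2 y) = braid_act c' 2 (U y)" if "y \<in> tensor_power I 3" for y
          using act_in[of _ 3 y] inter[of _ 3 y] that by simp_all
        have Ux: "U x \<in> tensor_power J 3"
          using U_iso[of 3] x by (auto simp: linear_iso_on_def bij_betw_def)
        have "inj_on U (tensor_power I 3)"
          using U_iso[of 3] by (simp add: linear_iso_on_def bij_betw_def)
        then show "braid_act c 1 (braid_act c 2 (braid_act c 1 x)) =
            braid_act c 2 (braid_act c 1 (braid_act c 2 x))"
          by (rule inj_onD) (use bvs' Ux x in
              \<open>simp_all add: U1 in1 braided_vector_space_def del: One_nat_def\<close>)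
      qed
    qed
    show "\<forall>m\<ge>2. linear_iso_on (tensor_power I m) (tensor_power J m) U \<and>
        (\<forall>i\<in>{1..m - 1}. \<forall>x\<in>tensor_power I m. U (braid_act c i x) = braid_act c' i (U x))"
      using U_iso inter by auto
  qed (rule bvs')
qed


section \<open>The dihedral rack with a two-valued cocycle\<close>

text \<open>A function \<open>y\<close> on the integers with \<open>y (x + m) = lam y x\<close> is determined by its values on
  \<open>{0..<m}\<close>, namely \<open>y x = wrap lam m x * y (x mod m)\<close>.\<close>

definition wrap :: "'k::field \<Rightarrow> nat \<Rightarrow> int \<Rightarrow> 'k"
  where "wrap lam m x = lam powi (x div int m)"

lemma powi_sq_1:
  fixes lam :: "'k::field"
  assumes "lam ^ 2 = 1"
  shows "lam powi (2 * a) = 1" "lam powi a * lam powi a = 1"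
    "lam powi (- a) = lam powi a"
proof -
  have nz: "lam \<noteq> 0" using assms by auto
  have "lam powi (2 * a) = (lam powi 2) powi a"
    by (rule power_int_mult)
  then show 1: "lam powi (2 * a) = 1" using assms by simp
  have "lam powi a * lam powi a = lam powi (2 * a)"
    using nz by (simp add: power_int_add[symmetric])
  then show 2: "lam powi a * lam powi a = 1" using 1 by simp
  then show "lam powi (- a) = lam powi a"
    using nz by (simp add: power_int_minus field_simps)
qed

lemma wrap_mult_self: "lam ^ 2 = 1 \<Longrightarrow> wrap lam m x * wrap lam m x = 1"
  by (simp add: wrap_def powi_sq_1)

lemma wrap_nonzero: "lam ^ 2 = 1 \<Longrightarrow> wrap lam m x \<noteq> 0"
  using wrap_mult_self[of lam m x] by auto

lemma wrap_shift:
  assumes "m > 0" "lam ^ 2 = 1"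
  shows "wrap lam m (x + int m * t) = wrap lam m x * lam powi t"
proof -
  have "lam \<noteq> 0" using assms by auto
  then show ?thesis using assms by (simp add: wrap_def power_int_add)
qed

lemma wrap_dihedral:
  assumes "m > 0" "lam ^ 2 = 1"
  shows "wrap lam m (2 * (x mod int m) - y mod int m) = wrap lam m (2 * x - y) * wrap lam m y"
proof -
  have nz: "lam \<noteq> 0" using assms by auto
  have "2 * (x mod int m) - y mod int m
      = (2 * x - y) + int m * (y div int m + 2 * (- (x div int m)))"
    by (simp add: minus_div_mult_eq_mod[symmetric] algebra_simps)
  moreover have "lam powi (y div int m + 2 * (- (x div int m))) = wrap lam m y"
    using nz by (simp add: power_int_add powi_sq_1[OF assms(2)] wrap_def del: mult_minus_right)
  ultimately show ?thesis
    by (simp only: wrap_shift[OF assms])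
qed

lemma dihedral_op_mod: "dihedral_op m (x mod int m) (y mod int m) = (2 * x - y) mod int m"
  unfolding dihedral_op_def by (intro mod_diff_cong mod_mult_right_eq mod_mod_trivial)

text \<open>The braiding with \<open>c (u\<^sub>i \<otimes> u\<^sub>j) = C u\<^sub>2\<^sub>i\<^sub>-\<^sub>j \<otimes> u\<^sub>i\<close> for all integers \<open>i\<close>, \<open>j\<close>, under the
  convention \<open>u\<^sub>x\<^sub>+\<^sub>m = lam u\<^sub>x\<close>.\<close>

definition dihedral_word :: "nat \<Rightarrow> 'k::field \<Rightarrow> 'k \<Rightarrow> int list \<Rightarrow> (int list \<Rightarrow>\<^sub>0 'k)"
  where "dihedral_word m lam C w =
    (C * wrap lam m (2 * w ! 0 - w ! 1)) *\<^sub>t bas [dihedral_op m (w ! 0) (w ! 1), w ! 0]"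

definition dihedral_braiding ::
    "nat \<Rightarrow> 'k::field \<Rightarrow> 'k \<Rightarrow> (int list \<Rightarrow>\<^sub>0 'k) \<Rightarrow> (int list \<Rightarrow>\<^sub>0 'k)"
  where "dihedral_braiding m lam C = lin_ext (dihedral_word m lam C)"

lemma braided_dihedral:
  fixes lam C :: "'k::field"
  assumes m: "m > 0" and lam: "lam ^ 2 = 1" and C: "C \<noteq> 0"
  shows "braided_vector_space {0..<int m} (dihedral_braiding m lam C)"
  unfolding braided_vector_space_def
proof
  have op: "dihedral_op m i j \<in> {0..<int m}" for i j
    using m by (simp add: dihedral_op_def)
  have inv1: "dihedral_op m i (dihedral_op m i j) = j" if "j \<in> {0..<int m}" for i j
    using that by (simp add: dihedral_op_def mod_diff_right_eq)
  show "linear_iso_on (tensor_power {0..<int m} 2) (tensor_power {0..<int m} 2)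
      (dihedral_braiding m lam C)"
    unfolding dihedral_braiding_def
  proof (rule linear_iso_on_monomial)
    show "dihedral_word m lam C w = (C * wrap lam m (2 * w ! 0 - w ! 1)) *\<^sub>t
        bas ((\<lambda>w. [dihedral_op m (w ! 0) (w ! 1), w ! 0]) w)" for w
      by (simp add: dihedral_word_def)
    show "C * wrap lam m (2 * w ! 0 - w ! 1) \<noteq> 0" for w
      using C wrap_nonzero[OF lam] by simp
    show "bij_betw (\<lambda>w. [dihedral_op m (w ! 0) (w ! 1), w ! 0])
        (words {0..<int m} 2) (words {0..<int m} 2)"
    proof (rule bij_betw_byWitness[where f' = "\<lambda>w. [w ! 1, dihedral_op m (w ! 1) (w ! 0)]"])
      show "(\<lambda>w. [dihedral_op m (w ! 0) (w ! 1), w ! 0]) ` words {0..<int m} 2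
          \<subseteq> words {0..<int m} 2"
        by (rule image_subsetI, elim words_2E) (use op in \<open>simp add: words_def\<close>)
      show "(\<lambda>w. [w ! 1, dihedral_op m (w ! 1) (w ! 0)]) ` words {0..<int m} 2
          \<subseteq> words {0..<int m} 2"
        by (rule image_subsetI, elim words_2E) (use op in \<open>simp add: words_def\<close>)
    qed (auto elim!: words_2E simp: inv1)
  qed
  define c where "c = dihedral_braiding m lam C"
  have c_bas: "c (bas [i, j]) = (C * wrap lam m (2 * i - j)) *\<^sub>t bas [dihedral_op m i j, i]" for i j
    by (simp add: c_def dihedral_braiding_def dihedral_word_def)
  have c1: "braid_act c 1 (bas [i, j, k])
      = (C * wrap lam m (2 * i - j)) *\<^sub>t bas [dihedral_op m i j, i, k]" for i j k
    using braid_act_bas[where c = c and u = "[]" and v = "[k]" and i = 1, OF c_bas] by simp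
  have c2: "braid_act c 2 (bas [i, j, k])
      = (C * wrap lam m (2 * j - k)) *\<^sub>t bas [i, dihedral_op m j k, j]" for i j k
    using braid_act_bas[where c = c and u = "[i]" and v = "[]" and i = 2, OF c_bas] by simp
  have "braid_act c 1 (braid_act c 2 (braid_act c 1 x)) =
      braid_act c 2 (braid_act c 1 (braid_act c 2 x))" if x: "x \<in> tensor_power {0..<int m} 3" for x
  proof -
    have "braid_act c 1 (braid_act c 2 (braid_act c 1 (lin_ext bas x))) =
        braid_act c 2 (braid_act c 1 (braid_act c 2 (lin_ext bas x)))"
      unfolding braid_act_lin_ext
    proof (rule lin_ext_cong)
      fix w assume "w \<in> Poly_Mapping.keys x"
      then obtain i j k where w: "w = [i, j, k]" and ijk: "i \<in> {0..<int m}" "j \<in> {0..<int m}"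
          "k \<in> {0..<int m}"
        using x by (auto simp: tensor_power_iff elim!: words_3E)
      \<comment> \<open>Both triple products are \<open>2 * i - 2 * j + k\<close> wrapped, times the common factor
        \<open>wrap lam m (2 * i - j)\<close>, because the other factors occur twice and square to 1.\<close>
      have l: "wrap lam m (2 * dihedral_op m i j - dihedral_op m i k)
          = wrap lam m (2 * i - 2 * j + k) * wrap lam m (2 * i - k)"
        using wrap_dihedral[OF m lam, of "2 * i - j" "2 * i - k"]
        by (simp add: dihedral_op_def algebra_simps)
      have r: "wrap lam m (2 * i - dihedral_op m j k)
          = wrap lam m (2 * i - 2 * j + k) * wrap lam m (2 * j - k)"
        using wrap_dihedral[OF m lam, of i "2 * j - k"] ijk
        by (simp add: dihedral_op_def algebra_simps)
      have sd: "dihedral_op m (dihedral_op m i j) (dihedral_op m i k)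
          = dihedral_op m i (dihedral_op m j k)"
        using dihedral_op_mod[of m "2 * i - j" "2 * i - k"] dihedral_op_mod[of m i "2 * j - k"] ijk
        by (simp add: dihedral_op_def algebra_simps)
      have coeff: "wrap lam m (2 * i - j) * (wrap lam m (2 * i - k)
            * wrap lam m (2 * dihedral_op m i j - dihedral_op m i k))
          = wrap lam m (2 * j - k) * (wrap lam m (2 * i - dihedral_op m j k)
            * wrap lam m (2 * i - j))"
        unfolding l r using wrap_mult_self[OF lam, of m "2 * i - k"]
          wrap_mult_self[OF lam, of m "2 * j - k"] by algebra
      show "braid_act c 1 (braid_act c 2 (braid_act c 1 (bas w))) =
          braid_act c 2 (braid_act c 1 (braid_act c 2 (bas w)))"
        unfolding w c1 c2 braid_act_tscale sd using coeff by (simp add: algebra_simps)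
    qed
    then show ?thesis by (simp add: lin_ext_bas_id)
  qed
  then show "\<forall>x\<in>tensor_power {0..<int m} 3.
      braid_act (dihedral_braiding m lam C) 1 (braid_act (dihedral_braiding m lam C) 2
        (braid_act (dihedral_braiding m lam C) 1 x)) =
      braid_act (dihedral_braiding m lam C) 2 (braid_act (dihedral_braiding m lam C) 1
        (braid_act (dihedral_braiding m lam C) 2 x))"
    by (simp add: c_def)
qed

lemma associated_dihedral_braiding:
  fixes lam C :: "'k::field"
  assumes m: "m > 0" and lam: "lam ^ 2 = 1" and C: "C \<noteq> 0"
  shows "associated_to_dihedral_rack m {0..<int m} (dihedral_braiding m lam C)"
proof -
  have "is_basis_family {0..<int m} (\<lambda>i. bas [i])
      (tensor_power {0..<int m} 1 :: (int list \<Rightarrow>\<^sub>0 'k) set)"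
    using is_basis_family_letters[of "\<lambda>i. i" "{0..<int m}", where 'k = 'k] by simp
  moreover have "C * wrap lam m (2 * i - j) \<noteq> 0 \<and>
      dihedral_braiding m lam C (bas [i] \<otimes>\<^sub>t bas [j])
        = (C * wrap lam m (2 * i - j)) *\<^sub>t (bas [dihedral_op m i j] \<otimes>\<^sub>t bas [i])" for i j
    using C wrap_nonzero[OF lam] by (simp add: dihedral_braiding_def dihedral_word_def)
  ultimately show ?thesis
    unfolding associated_to_dihedral_rack_def using braided_dihedral[OF assms]
    by (intro conjI exI[of _ "\<lambda>i. bas [i]"] exI[of _ "\<lambda>i j. C * wrap lam m (2 * i - j)"])
      simp_all
qed


section \<open>Unfolding the braiding along the integers\<close>

text \<open>Write \<open>w\<^sub>x = B\<^sup>x u\<^sub>x\<close> and extend \<open>u\<close> to all integers by the reflections \<open>u\<^sub>x = (-1)\<^sup>p u\<^sub>1\<^sub>-\<^sub>x\<close>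
  and \<open>u\<^sub>x = (-1)\<^sup>p lam u\<^sub>4\<^sub>n\<^sub>+\<^sub>3\<^sub>-\<^sub>x\<close> at the two ends of \<open>{1..2n+1}\<close>.  An integer \<open>x\<close> in
  \<open>{1-2n..4n+2}\<close> is then equivalent to \<open>reflect n x\<close> in \<open>{1..2n+1}\<close>, and \<open>w\<^sub>x\<close> is
  \<open>reflect_coeff n p lam B x\<close> times \<open>w\<close> at \<open>reflect n x\<close>.\<close>

definition reflect :: "nat \<Rightarrow> int \<Rightarrow> int"
  where "reflect n x = (if x < 1 then 1 - x else if x \<le> 2 * int n + 1 then x else 4 * int n + 3 - x)"

definition reflect_coeff :: "nat \<Rightarrow> nat \<Rightarrow> 'k::field \<Rightarrow> 'k \<Rightarrow> int \<Rightarrow> 'k"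
  where "reflect_coeff n p lam B x =
    (if x < 1 then (-1) ^ p * B powi (2 * x - 1)
     else if x \<le> 2 * int n + 1 then 1
     else (-1) ^ p * lam * B powi (2 * x - 4 * int n - 3))"

lemma R_op_reflect:
  assumes "\<beta> + \<gamma> \<ge> 1"
  shows "R_op n p lam B \<gamma> \<alpha> \<beta>
    = reflect_coeff n p lam B (\<beta> + \<gamma>) *\<^sub>t bas [reflect n (\<beta> + \<gamma>), 2 * int n + 2 - \<alpha>]"
proof -
  consider "\<beta> + \<gamma> \<le> 2 * int n + 1" | "\<beta> + \<gamma> = 2 * int n + 2" | "\<beta> + \<gamma> \<ge> 2 * int n + 3"
    by linarith
  then show ?thesis
  proof cases
    case 2
    have "2 * (2 * int n + 2) - 4 * int n - 3 = 1" by simp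
    then show ?thesis
      unfolding R_op_def reflect_coeff_def reflect_def 2 by (simp add: algebra_simps)
  qed (use assms in \<open>auto simp: R_op_def reflect_coeff_def reflect_def algebra_simps\<close>)
qed

lemma L_op_reflect:
  assumes "B \<noteq> 0" "\<gamma> \<ge> 0" "\<beta> \<le> 2 * int n + 1"
  shows "L_op n p B \<gamma> \<alpha> \<beta>
    = (B powi (2 * \<gamma>) * reflect_coeff n p lam B (\<beta> - \<gamma>)) *\<^sub>t
        bas [reflect n (\<beta> - \<gamma>), 2 * int n + 2 - \<alpha>]"
proof (cases "\<gamma> < \<beta>")
  case True
  then show ?thesis
    using assms by (auto simp: L_op_def reflect_coeff_def reflect_def algebra_simps)
next
  case False
  have "B powi (2 * \<gamma>) * B powi (2 * (\<beta> - \<gamma>) - 1) = B powi (2 * \<beta> - 1)"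
    using assms by (simp add: power_int_add[symmetric])
  then show ?thesis
    using False assms
    by (simp add: L_op_def reflect_coeff_def reflect_def algebra_simps)
qed

text \<open>The place on the line, before reflection, to which the braiding moves \<open>w\<^sub>\<beta>\<close> past \<open>w\<^sub>\<alpha>\<close>.\<close>

definition target :: "nat \<Rightarrow> int \<Rightarrow> int \<Rightarrow> int"
  where "target n \<alpha> \<beta> =
    (if even (\<alpha> + \<beta>) then \<beta> + 2 * (\<alpha> - int n - 1) else \<beta> - 2 * (\<alpha> - int n - 1))"

text \<open>The scalar of \<open>c (w\<^sub>\<alpha> \<otimes> w\<^sub>\<beta>)\<close>, including the one from the reflection into \<open>{1..2n+1}\<close>.\<close>

definition suzuki_coeff ::
    "nat \<Rightarrow> nat \<Rightarrow> nat \<Rightarrow> nat \<Rightarrow> 'k::field \<Rightarrow> 'k \<Rightarrow> int \<Rightarrow> int \<Rightarrow> 'k"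
  where "suzuki_coeff n s p q lam B \<alpha> \<beta> =
    (-1) ^ q * B powi (2 * (int s + int n))
      * (if even (\<alpha> + \<beta>) then 1 else B powi (4 * (\<alpha> - int n - 1)))
      * reflect_coeff n p lam B (target n \<alpha> \<beta>)"

text \<open>On the line the five cases of the braiding collapse to two, told apart by the parity of
  \<open>\<alpha> + \<beta>\<close>.\<close>

lemma suzuki_braiding_basis_eq:
  assumes B: "B \<noteq> 0" and \<alpha>: "\<alpha> \<in> {1..2 * int n + 1}" and \<beta>: "\<beta> \<in> {1..2 * int n + 1}"
  shows "suzuki_braiding_basis n s p q lam B \<alpha> \<beta>
    = suzuki_coeff n s p q lam B \<alpha> \<beta> *\<^sub>t bas [reflect n (target n \<alpha> \<beta>), 2 * int n + 2 - \<alpha>]"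
proof -
  consider (mid) "\<alpha> = int n + 1"
    | (lo_even) "\<alpha> < int n + 1" "even (\<alpha> + \<beta>)" | (lo_odd) "\<alpha> < int n + 1" "odd (\<alpha> + \<beta>)"
    | (hi_even) "\<alpha> > int n + 1" "even (\<alpha> + \<beta>)" | (hi_odd) "\<alpha> > int n + 1" "odd (\<alpha> + \<beta>)"
    by linarith
  then show ?thesis
  proof cases
    case mid
    then show ?thesis
      using \<beta> by (simp add: suzuki_braiding_basis_def suzuki_coeff_def target_def
          reflect_coeff_def reflect_def algebra_simps)
  next
    case lo_even
    have t: "target n \<alpha> \<beta> = \<beta> - 2 * (int n - \<alpha> + 1)"
      using lo_even by (simp add: target_def)
    have "B powi (2 * (2 * \<alpha> + int s - int n - 2)) * B powi (2 * (2 * (int n - \<alpha> + 1)))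
        = B powi (2 * (int s + int n))"
      using B by (simp add: power_int_add[symmetric] algebra_simps)
    then show ?thesis
      using lo_even \<beta>
      by (simp add: suzuki_braiding_basis_def suzuki_coeff_def t
          L_op_reflect[OF B, where lam = lam] mult.assoc[symmetric])
  next
    case lo_odd
    have t: "target n \<alpha> \<beta> = \<beta> + 2 * (int n - \<alpha> + 1)"
      using lo_odd by (simp add: target_def)
    have "B powi (2 * (int s + int n)) * B powi (4 * (\<alpha> - int n - 1))
        = B powi (2 * (2 * \<alpha> + int s - int n - 2))"
      using B by (simp add: power_int_add[symmetric] algebra_simps)
    then show ?thesis
      using lo_odd \<beta>
      by (simp add: suzuki_braiding_basis_def suzuki_coeff_def t R_op_reflect mult.assoc[symmetric])
  next
    case hi_even
    have t: "target n \<alpha> \<beta> = \<beta> + 2 * (\<alpha> - 1 - int n)"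
      using hi_even by (simp add: target_def)
    then show ?thesis
      using hi_even \<beta>
      by (simp add: suzuki_braiding_basis_def suzuki_coeff_def t R_op_reflect)
  next
    case hi_odd
    have t: "target n \<alpha> \<beta> = \<beta> - 2 * (\<alpha> - 1 - int n)"
      using hi_odd by (simp add: target_def)
    have "4 * (\<alpha> - int n - 1) = 2 * (2 * (\<alpha> - 1 - int n))" by simp
    then show ?thesis
      using hi_odd \<beta>
      by (simp only: suzuki_braiding_basis_def suzuki_coeff_def t)
         (simp add: L_op_reflect[OF B, where lam = lam] mult.assoc)
  qed
qed

text \<open>The reflections identify every integer with an odd one, and \<open>u\<close> on the odd integers has
  period \<open>4n+2\<close> up to \<open>lam\<close>.  So \<open>u\<^sub>x\<close> is \<open>parity_sign p x\<close> times the rack element with index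
  \<open>rack_index x\<close>, where index \<open>i\<close> stands for \<open>u\<^sub>2\<^sub>i\<^sub>+\<^sub>1\<close>.\<close>

definition rack_index :: "int \<Rightarrow> int"
  where "rack_index x = (if odd x then (x - 1) div 2 else - (x div 2))"

definition parity_sign :: "nat \<Rightarrow> int \<Rightarrow> 'k::field"
  where "parity_sign p x = (if odd x then 1 else (-1) ^ p)"

text \<open>The index of \<open>2n+2-\<alpha>\<close> is \<open>n\<close> minus the index of \<open>\<alpha>\<close>, up to this multiple of \<open>2n+1\<close>.\<close>

definition flip_shift :: "int \<Rightarrow> int"
  where "flip_shift \<alpha> = (if odd \<alpha> then 0 else -1)"

lemma rack_index_flip:
  "rack_index \<alpha> = int n - rack_index (2 * int n + 2 - \<alpha>) + int (2 * n + 1) * flip_shift \<alpha>"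
  by (auto simp: rack_index_def flip_shift_def elim!: evenE oddE)

lemma rack_index_target:
  "2 * rack_index \<alpha> + rack_index \<beta> - int n
    = rack_index (target n \<alpha> \<beta>) + int (2 * n + 1) * flip_shift \<alpha>"
proof -
  obtain a where a: "\<alpha> = 2 * a \<or> \<alpha> = 2 * a + 1" by (metis evenE oddE)
  obtain b where b: "\<beta> = 2 * b \<or> \<beta> = 2 * b + 1" by (metis evenE oddE)
  from a b show ?thesis
    by (elim disjE) (simp_all add: rack_index_def target_def flip_shift_def)
qed

lemma parity_sign_target: "parity_sign p (target n \<alpha> \<beta>) = parity_sign p \<beta>"
  by (simp add: parity_sign_def target_def)

lemma reflect_rack_index:
  fixes lam B :: "'k::field"
  assumes B: "B \<noteq> 0" and lam: "lam ^ 2 = 1"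
  obtains t where "rack_index x = rack_index (reflect n x) + int (2 * n + 1) * t"
    and "reflect_coeff n p lam B x * B powi reflect n x * parity_sign p (reflect n x)
      = B powi x * parity_sign p x * lam powi t"
proof -
  have sq: "(-1) ^ p * (-1) ^ p = (1 :: 'k)"
    by (simp add: power_mult_distrib[symmetric])
  consider "x < 1" | "1 \<le> x" "x \<le> 2 * int n + 1" | "x > 2 * int n + 1" by linarith
  then show thesis
  proof cases
    case 1
    have "B powi (2 * x - 1) * B powi (1 - x) = B powi x"
      using B by (simp add: power_int_add[symmetric])
    moreover have "rack_index x = rack_index (1 - x)"
      by (auto simp: rack_index_def elim!: evenE oddE)
    ultimately show thesis
      using 1 sq by (intro that[of 0]) (auto simp: reflect_def reflect_coeff_def parity_sign_def
          mult_ac)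
  next
    case 2
    then show thesis
      by (intro that[of 0]) (auto simp: reflect_def reflect_coeff_def)
  next
    case 3
    define t :: int where "t = (if odd x then 1 else -1)"
    have "B powi (2 * x - 4 * int n - 3) * B powi (4 * int n + 3 - x) = B powi x"
      using B by (simp add: power_int_add[symmetric])
    moreover have "lam powi t = lam"
      using powi_sq_1(3)[OF lam, of 1] by (simp add: t_def)
    moreover have "rack_index x = rack_index (4 * int n + 3 - x) + int (2 * n + 1) * t"
      by (auto simp: rack_index_def t_def elim!: evenE oddE)
    ultimately show thesis
      using 3 sq by (intro that[of t]) (auto simp: reflect_def reflect_coeff_def parity_sign_def
          mult_ac)
  qed
qed


lemma rack_index_inj:
  assumes "\<alpha> \<in> {1..2 * int n + 1}" "\<beta> \<in> {1..2 * int n + 1}"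
    and "rack_index \<alpha> mod int (2 * n + 1) = rack_index \<beta> mod int (2 * n + 1)"
  shows "\<alpha> = \<beta>"
proof -
  have bound: "- int n \<le> rack_index x \<and> rack_index x \<le> int n" if "x \<in> {1..2 * int n + 1}" for x
    using that by (auto simp: rack_index_def elim!: evenE oddE)
  have "int (2 * n + 1) dvd rack_index \<alpha> - rack_index \<beta>"
    using assms(3) by (simp add: mod_eq_dvd_iff)
  moreover have "\<bar>rack_index \<alpha> - rack_index \<beta>\<bar> < int (2 * n + 1)"
    using bound[OF assms(1)] bound[OF assms(2)] by linarith
  ultimately have "rack_index \<alpha> = rack_index \<beta>"
    using zdvd_imp_le[of "int (2 * n + 1)" "\<bar>rack_index \<alpha> - rack_index \<beta>\<bar>"] by fastforce
  then show ?thesis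
    using assms(1,2) by (auto simp: rack_index_def split: if_splits elim!: evenE oddE)
qed


section \<open>The t-equivalence\<close>

text \<open>On the rack elements the involution \<open>u\<^sub>a \<mapsto> u\<^sub>2\<^sub>n\<^sub>+\<^sub>2\<^sub>-\<^sub>a\<close>, for odd \<open>a\<close>, is \<open>i \<mapsto> n - i\<close>; the
  t-equivalence applies it to every second tensor factor.\<close>

definition rack_index_at :: "nat \<Rightarrow> nat \<Rightarrow> int \<Rightarrow> int"
  where "rack_index_at n k \<alpha> = (if even k then rack_index \<alpha> else int n - rack_index \<alpha>)"

text \<open>The basis vector \<open>w\<^sub>\<alpha>\<close> in tensor position \<open>k\<close>, counted from 0, is sent to \<open>rack_coeff\<close> times
  the rack element \<open>rack_letter\<close>.\<close>

definition rack_letter :: "nat \<Rightarrow> nat \<Rightarrow> int \<Rightarrow> int"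
  where "rack_letter n k \<alpha> = rack_index_at n k \<alpha> mod int (2 * n + 1)"

definition rack_coeff :: "nat \<Rightarrow> nat \<Rightarrow> 'k::field \<Rightarrow> 'k \<Rightarrow> nat \<Rightarrow> int \<Rightarrow> 'k"
  where "rack_coeff n p lam B k \<alpha> =
    B powi \<alpha> * parity_sign p \<alpha> * wrap lam (2 * n + 1) (rack_index_at n k \<alpha>)"

lemma bij_betw_rack_letter:
  "bij_betw (rack_letter n k) {1..2 * int n + 1} {0..<int (2 * n + 1)}"
proof -
  let ?I = "{1..2 * int n + 1}" and ?J = "{0..<int (2 * n + 1)}"
  have "inj_on (rack_letter n k) ?I"
  proof (rule inj_onI)
    fix x y assume xy: "x \<in> ?I" "y \<in> ?I" "rack_letter n k x = rack_letter n k y"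
    have "rack_index x mod int (2 * n + 1) = rack_index y mod int (2 * n + 1)"
    proof (cases "even k")
      case False
      then have "int (2 * n + 1) dvd (int n - rack_index x) - (int n - rack_index y)"
        using xy(3) by (simp only: rack_letter_def rack_index_at_def mod_eq_dvd_iff if_False)
      then have "int (2 * n + 1) dvd rack_index y - rack_index x"
        by (simp add: algebra_simps)
      then show ?thesis by (metis mod_eq_dvd_iff)
    qed (use xy in \<open>simp add: rack_letter_def rack_index_at_def\<close>)
    then show "x = y" using rack_index_inj xy by blast
  qed
  moreover have "rack_letter n k ` ?I \<subseteq> ?J"
    by (auto simp: rack_letter_def)
  moreover have "card (rack_letter n k ` ?I) = card ?J"
    using calculation(1) by (simp add: card_image)
  ultimately show ?thesis
    by (metis bij_betw_def card_subset_eq finite_atLeastLessThan_int)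
qed

lemma suzuki_t_equivalent_dihedral:
  fixes lam B :: "'k::field"
  assumes B: "B \<noteq> 0" and lam: "lam ^ 2 = 1"
  shows "t_equivalent {1..2 * int n + 1} (suzuki_braiding n s p q lam B)
    {0..<int (2 * n + 1)}
    (dihedral_braiding (2 * n + 1) lam ((-1) ^ q * B powi (2 * (int s + int n))))"
proof -
  define m where "m = 2 * n + 1"
  define I where "I = {1..2 * int n + 1}"
  define C where "C = (-1) ^ q * B powi (2 * (int s + int n))"
  define g where "g = (\<lambda>\<alpha> \<beta>. reflect n (target n \<alpha> \<beta>))"
  define h where "h = (\<lambda>\<alpha> \<beta> :: int. 2 * int n + 2 - \<alpha>)"
  have m: "m > 0" by (simp add: m_def)
  have C: "C \<noteq> 0" using B by (simp add: C_def)
  have nz: "lam \<noteq> 0" using lam by auto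
  \<comment> \<open>The first tensor factor of the image.  For odd \<open>k\<close> both indices are flipped, which only
    changes the sign of \<open>t\<close>, and \<open>lam powi t\<close> does not see that sign.\<close>
  have index_at: "\<exists>t. 2 * rack_index_at n k \<alpha> - rack_index_at n (Suc k) \<beta>
        = rack_index_at n k (g \<alpha> \<beta>) + int m * t
      \<and> suzuki_coeff n s p q lam B \<alpha> \<beta> * B powi (g \<alpha> \<beta>) * parity_sign p (g \<alpha> \<beta>) * B powi (h \<alpha> \<beta>)
        = C * B powi \<alpha> * B powi \<beta> * parity_sign p \<beta> * lam powi t * lam powi (flip_shift \<alpha>)"
    for k \<alpha> \<beta>
  proof -
    let ?x = "target n \<alpha> \<beta>"
    obtain t where t: "rack_index ?x = rack_index (g \<alpha> \<beta>) + int m * t"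
      and c: "reflect_coeff n p lam B ?x * B powi (g \<alpha> \<beta>) * parity_sign p (g \<alpha> \<beta>)
        = B powi ?x * parity_sign p ?x * lam powi t"
      using reflect_rack_index[OF B lam] unfolding g_def m_def by metis
    define e where "e = (if even (\<alpha> + \<beta>) then 0 else 4 * (\<alpha> - int n - 1))"
    have "suzuki_coeff n s p q lam B \<alpha> \<beta> = C * B powi e * reflect_coeff n p lam B ?x"
      by (simp add: suzuki_coeff_def C_def e_def)
    then have "suzuki_coeff n s p q lam B \<alpha> \<beta> * B powi (g \<alpha> \<beta>) * parity_sign p (g \<alpha> \<beta>)
          * B powi (h \<alpha> \<beta>)
        = C * B powi e * B powi (h \<alpha> \<beta>) * (B powi ?x * parity_sign p ?x * lam powi t)"
      unfolding c[symmetric] by (simp add: mult_ac)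
    also have "\<dots> = C * (B powi e * B powi (h \<alpha> \<beta>) * B powi ?x) * parity_sign p \<beta> * lam powi t"
      by (simp add: parity_sign_target mult_ac)
    also have "B powi e * B powi (h \<alpha> \<beta>) * B powi ?x = B powi \<alpha> * B powi \<beta>"
      using B by (simp add: power_int_add[symmetric] e_def h_def target_def algebra_simps)
    also have "lam powi t = lam powi (t + flip_shift \<alpha>) * lam powi (flip_shift \<alpha>)"
      using nz powi_sq_1(2)[OF lam, of "flip_shift \<alpha>"] by (simp add: power_int_add)
    finally have coeff: "suzuki_coeff n s p q lam B \<alpha> \<beta> * B powi (g \<alpha> \<beta>) * parity_sign p (g \<alpha> \<beta>)
          * B powi (h \<alpha> \<beta>)
        = C * B powi \<alpha> * B powi \<beta> * parity_sign p \<beta> * lam powi (t + flip_shift \<alpha>)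
          * lam powi (flip_shift \<alpha>)"
      by (simp add: mult_ac)
    have "2 * rack_index \<alpha> + rack_index \<beta> - int n
        = rack_index (g \<alpha> \<beta>) + int m * (t + flip_shift \<alpha>)"
      using rack_index_target[of \<alpha> \<beta> n] t by (simp add: m_def algebra_simps)
    then show ?thesis
      using coeff powi_sq_1(3)[OF lam, of "t + flip_shift \<alpha>"]
      by (intro exI[of _ "if even k then t + flip_shift \<alpha> else - (t + flip_shift \<alpha>)"])
        (auto simp: rack_index_at_def algebra_simps)
  qed
  \<comment> \<open>The second tensor factor: the flip is undone by the change of position.\<close>
  have flip_at: "\<exists>t. rack_index_at n k \<alpha> = rack_index_at n (Suc k) (h \<alpha> \<beta>) + int m * t
      \<and> lam powi t = lam powi (flip_shift \<alpha>)" for k \<alpha> \<beta>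
    using rack_index_flip[of \<alpha> n] powi_sq_1(3)[OF lam, of "flip_shift \<alpha>"]
    by (intro exI[of _ "if even k then flip_shift \<alpha> else - flip_shift \<alpha>"])
      (auto simp: rack_index_at_def h_def m_def algebra_simps)
  have "t_equivalent I (suzuki_braiding n s p q lam B) {0..<int m} (dihedral_braiding m lam C)"
  proof (rule t_equivalent_subst[where lt = "rack_letter n" and cf = "rack_coeff n p lam B"
        and q = "suzuki_coeff n s p q lam B" and g = g and h = h
        and q' = "\<lambda>i j. C * wrap lam m (2 * i - j)" and g' = "dihedral_op m" and h' = "\<lambda>i j. i"])
    show "suzuki_braiding n s p q lam B
        = lin_ext (\<lambda>w. suzuki_braiding_basis n s p q lam B (w ! 0) (w ! 1))"
      by (simp add: suzuki_braiding_def)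
    show "suzuki_braiding_basis n s p q lam B ([a, b] ! 0) ([a, b] ! 1)
        = suzuki_coeff n s p q lam B a b *\<^sub>t bas [g a b, h a b]" if "a \<in> I" "b \<in> I" for a b
      using suzuki_braiding_basis_eq[OF B] that by (simp add: g_def h_def I_def)
    show "g a b \<in> I \<and> h a b \<in> I" if "a \<in> I" "b \<in> I" for a b
      using that by (auto simp: g_def h_def I_def reflect_def target_def)
    show "dihedral_braiding m lam C = lin_ext (dihedral_word m lam C)"
      by (simp add: dihedral_braiding_def)
    show "dihedral_word m lam C [a, b] = (C * wrap lam m (2 * a - b)) *\<^sub>t bas [dihedral_op m a b, a]"
      for a b
      by (simp add: dihedral_word_def)
    show "braided_vector_space {0..<int m} (dihedral_braiding m lam C)"
      by (rule braided_dihedral[OF m lam C])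
    show "bij_betw (rack_letter n k) I {0..<int m}" for k
      unfolding I_def m_def by (rule bij_betw_rack_letter)
    show "rack_coeff n p lam B k a \<noteq> 0" for k a
      using B wrap_nonzero[OF lam] by (simp add: rack_coeff_def parity_sign_def)
    show "dihedral_op m (rack_letter n k a) (rack_letter n (Suc k) b) = rack_letter n k (g a b)"
      for k a b
    proof -
      obtain t where t: "2 * rack_index_at n k a - rack_index_at n (Suc k) b
          = rack_index_at n k (g a b) + int m * t"
        using index_at by blast
      have "dihedral_op m (rack_letter n k a) (rack_letter n (Suc k) b)
          = (2 * rack_index_at n k a - rack_index_at n (Suc k) b) mod int m"
        unfolding rack_letter_def m_def[symmetric] by (rule dihedral_op_mod)
      then show ?thesis by (simp add: t rack_letter_def m_def)
    qed
    show "rack_letter n k a = rack_letter n (Suc k) (h a b)" for k a b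
    proof -
      obtain t where "rack_index_at n k a = rack_index_at n (Suc k) (h a b) + int m * t"
        using flip_at by blast
      then show ?thesis by (simp add: rack_letter_def m_def)
    qed
    show "rack_coeff n p lam B k a * rack_coeff n p lam B (Suc k) b
        * (C * wrap lam m (2 * rack_letter n k a - rack_letter n (Suc k) b))
      = suzuki_coeff n s p q lam B a b
        * (rack_coeff n p lam B k (g a b) * rack_coeff n p lam B (Suc k) (h a b))" for k a b
    proof -
      let ?x = "rack_index_at n k a" and ?y = "rack_index_at n (Suc k) b"
      let ?gx = "rack_index_at n k (g a b)" and ?hx = "rack_index_at n (Suc k) (h a b)"
      obtain t where t: "2 * ?x - ?y = ?gx + int m * t"
        and c: "suzuki_coeff n s p q lam B a b * B powi (g a b) * parity_sign p (g a b)
            * B powi (h a b)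
          = C * B powi a * B powi b * parity_sign p b * lam powi t * lam powi (flip_shift a)"
        using index_at by blast
      obtain t' where t': "?x = ?hx + int m * t'" and lt': "lam powi t' = lam powi (flip_shift a)"
        using flip_at by blast
      have w: "wrap lam m (2 * rack_letter n k a - rack_letter n (Suc k) b)
          = wrap lam m ?gx * lam powi t * wrap lam m ?y"
        unfolding rack_letter_def m_def[symmetric] wrap_dihedral[OF m lam] t wrap_shift[OF m lam] ..
      have wx: "wrap lam m ?x = wrap lam m ?hx * lam powi (flip_shift a)"
        unfolding t' wrap_shift[OF m lam] lt' ..
      have rc: "rack_coeff n p lam B j x
          = B powi x * parity_sign p x * wrap lam m (rack_index_at n j x)" for j x
        by (simp only: rack_coeff_def m_def)
      have ph: "parity_sign p (h a b) = (parity_sign p a :: 'k)"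
        by (simp add: parity_sign_def h_def)
      have "rack_coeff n p lam B k a * rack_coeff n p lam B (Suc k) b
          * (C * wrap lam m (2 * rack_letter n k a - rack_letter n (Suc k) b))
        = (C * B powi a * B powi b * parity_sign p b * lam powi t * lam powi (flip_shift a))
          * parity_sign p a * wrap lam m ?hx * wrap lam m ?gx * (wrap lam m ?y * wrap lam m ?y)"
        unfolding w by (simp add: rc wx mult_ac)
      also have "\<dots> = suzuki_coeff n s p q lam B a b
          * (rack_coeff n p lam B k (g a b) * rack_coeff n p lam B (Suc k) (h a b))"
        unfolding c[symmetric] wrap_mult_self[OF lam]
        by (simp add: rc ph mult_ac)
      finally show ?thesis .
    qed
  qed
  then show ?thesis by (simp add: I_def m_def C_def)
qed

theorem theorem3p7:
  fixes N n s k p q :: nat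
    and mu lam \<omega> r B :: "'k :: {alg_closed_field, field_char_0}"
    and mubar :: "'k \<Rightarrow> 'k"
  assumes "N \<ge> 1" and "n \<ge> 1"
    and "mu \<in> {1, -1}" and "lam \<in> {1, -1}"
    and "s \<in> {1..N}" and "k \<in> {0..N - 1}"
    and "p \<in> {0, 1}" and "q \<in> {0, 1}"
    and "primitive_root_of_unity (8 * N * (2 * n + 1)) \<omega>"
    and "mubar mu \<noteq> 0" and "r ^ 2 = mubar mu"
    and "B = r * \<omega> ^ (2 * k * (2 * n + 1))"
  shows "\<exists>(J :: int set) (c' :: (int list \<Rightarrow>\<^sub>0 'k) \<Rightarrow> (int list \<Rightarrow>\<^sub>0 'k)).
           braided_vector_space J c' \<and>
           associated_to_dihedral_rack (2 * n + 1) J c' \<and>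
           t_equivalent {1..2 * int n + 1} (suzuki_braiding n s p q lam B) J c'"
proof -
  have "r \<noteq> 0" using assms(10,11) by auto
  moreover have "\<omega> \<noteq> 0"
  proof
    assume "\<omega> = 0"
    then show False
      using assms(9) by (auto simp: primitive_root_of_unity_def power_0_left split: if_splits)
  qed
  ultimately have B: "B \<noteq> 0" using assms(12) by simp
  have lam: "lam ^ 2 = 1" using assms(4) by auto
  define C where "C = (-1) ^ q * B powi (2 * (int s + int n))"
  have C: "C \<noteq> 0" using B by (simp add: C_def)
  have m: "2 * n + 1 > 0" by simp
  show ?thesis
    using braided_dihedral[OF m lam C] associated_dihedral_braiding[OF m lam C]
      suzuki_t_equivalent_dihedral[OF B lam, of n s p q]
    unfolding C_def[symmetric] by blast
qed

end
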